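(* Let $T$ be a tree with $|E(T)|\ge 2$. Then $\chi'_{CF}(T)=2$ if and only if there exists a nonempty proper subset $F\subseteq E(T)$ such that, for every edge $uv\in E(T)$, both of the following implications hold: (i) if $uv\in F$, then $d_F(u)+d_F(v)=2$ or $(d_T(u)-d_F(u))+(d_T(v)-d_F(v))=1$; (ii) if $uv\notin F$, then $d_F(u)+d_F(v)=1$ or $(d_T(u)-d_F(u))+(d_T(v)-d_F(v))=2$.
   Context: All graphs are finite and simple. For a tree $T$, a vertex $v$ and a set $F\subseteq E(T)$, $d_T(v)$ is the degree of $v$ in $T$ and $d_F(v)$ is the number of edges of $F$ incident with $v$. For a graph $G$ and a vertex $v$, $E_G(v)$ denotes the set of edges of $G$ incident with $v$, and for an edge $uv\in E(G)$ its closed neighborhood is $E_G[uv]:=E_G(u)\cup E_G(v)$ (this contains $uv$ itself). An edge $k$-coloring of $G$ is any assignment of colors from $\{1,\dots,k\}$ to the edges of $G$ (not necessarily proper). It is conflict-free if for every edge $uv\in E(G)$ there is a color that appears on exactly one edge of $E_G[uv]$. The conflict-free chromatic index $\chi'_{CF}(G)$ is the least $k$ such that $G$ has a conflict-free edge $k$-coloring. *)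

theory Defs
  imports Main
begin

record 'a graph =
  verts :: "'a set"
  edges :: "'a set set"

definition simple_graph :: "'a graph \<Rightarrow> bool" where
  "simple_graph G \<longleftrightarrow>
     finite (verts G) \<and> (\<forall>e\<in>edges G. e \<subseteq> verts G \<and> card e = 2)"

definition adj :: "'a graph \<Rightarrow> 'a \<Rightarrow> 'a \<Rightarrow> bool" where
  "adj G u v \<longleftrightarrow> {u, v} \<in> edges G"

definition connected_graph :: "'a graph \<Rightarrow> bool" where
  "connected_graph G \<longleftrightarrow>
     verts G \<noteq> {} \<and> (\<forall>u\<in>verts G. \<forall>v\<in>verts G. (adj G)\<^sup>*\<^sup>* u v)"

(* A cycle is listed without repeating its first vertex at the end. *)
definition is_cycle :: "'a graph \<Rightarrow> 'a list \<Rightarrow> bool" where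
  "is_cycle G xs \<longleftrightarrow>
     length xs \<ge> 3 \<and> distinct xs \<and> successively (adj G) xs \<and> adj G (last xs) (hd xs)"

definition tree :: "'a graph \<Rightarrow> bool" where
  "tree T \<longleftrightarrow> simple_graph T \<and> connected_graph T \<and> (\<nexists>xs. is_cycle T xs)"

definition incident_edges :: "'a set set \<Rightarrow> 'a \<Rightarrow> 'a set set" where
  "incident_edges F v = {e \<in> F. v \<in> e}"

(* For F a set of edges of T this is d_F(v); for F = edges T it is d_T(v). *)
definition degree_in :: "'a set set \<Rightarrow> 'a \<Rightarrow> nat" where
  "degree_in F v = card (incident_edges F v)"

definition closed_edge_nbhd :: "'a graph \<Rightarrow> 'a \<Rightarrow> 'a \<Rightarrow> 'a set set" where
  "closed_edge_nbhd G u v = incident_edges (edges G) u \<union> incident_edges (edges G) v"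

(* Colors of sets outside "edges G" are irrelevant; colorings need not be proper. *)
definition edge_coloring :: "'a graph \<Rightarrow> nat \<Rightarrow> ('a set \<Rightarrow> nat) \<Rightarrow> bool" where
  "edge_coloring G k c \<longleftrightarrow> (\<forall>e\<in>edges G. c e \<in> {1..k})"

definition conflict_free :: "'a graph \<Rightarrow> ('a set \<Rightarrow> nat) \<Rightarrow> bool" where
  "conflict_free G c \<longleftrightarrow>
     (\<forall>u v. {u, v} \<in> edges G \<longrightarrow> (\<exists>i. \<exists>!e. e \<in> closed_edge_nbhd G u v \<and> c e = i))"

definition cf_chromatic_index :: "'a graph \<Rightarrow> nat" where
  "cf_chromatic_index G = (LEAST k. \<exists>c. edge_coloring G k c \<and> conflict_free G c)"

(* The minimum is over a nonempty set: color all edges differently. *)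
lemma ex_conflict_free_edge_coloring:
  assumes "simple_graph G"
  shows "\<exists>k c. edge_coloring G k c \<and> conflict_free G c"
proof -
  have "edges G \<subseteq> Pow (verts G)" "finite (verts G)"
    using assms by (auto simp: simple_graph_def)
  then have "finite (edges G)"
    by (meson finite_Pow_iff finite_subset)
  then obtain h where h: "bij_betw h (edges G) {0..<card (edges G)}"
    using ex_bij_betw_finite_nat by blast
  have "edge_coloring G (card (edges G)) (Suc \<circ> h)"
    using bij_betwE[OF h] by (auto simp: edge_coloring_def Suc_le_eq)
  moreover have "conflict_free G (Suc \<circ> h)"
    unfolding conflict_free_def
  proof (intro allI impI)
    fix u v assume "{u, v} \<in> edges G"
    then show "\<exists>i. \<exists>!e. e \<in> closed_edge_nbhd G u v \<and> (Suc \<circ> h) e = i"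
      using bij_betw_imp_inj_on[OF h]
      by (intro exI[of _ "Suc (h {u, v})"] ex1I[of _ "{u, v}"])
        (auto simp: closed_edge_nbhd_def incident_edges_def dest: inj_onD)
  qed
  ultimately show ?thesis by blast
qed

end

theory Submission
  imports Defs
begin

text \<open>
  A coloring with two colors is the same thing as the set \<open>F\<close> of edges of color 1, and it is
  conflict-free at an edge \<open>uv\<close> iff the closed neighborhood of \<open>uv\<close> contains exactly one edge of
  \<open>F\<close> or exactly one edge outside \<open>F\<close>.  In a simple graph \<open>uv\<close> is the only edge at both \<open>u\<close> and
  \<open>v\<close>, so for every edge set \<open>H\<close> the sum \<open>d\<^sub>H(u) + d\<^sub>H(v)\<close> counts the edges of \<open>H\<close> in that
  neighborhood, with \<open>uv\<close> counted twice if it lies in \<open>H\<close> (\<open>degree_in_add_eq_card\<close>).  Taking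
  \<open>H = F\<close> and \<open>H = E(T) - F\<close> turns ``exactly one'' into the values 1 and 2 of the implications
  (i) and (ii) (\<open>degree_conditions_iff\<close>).

  The remaining point is that neither fewer colors nor a trivial \<open>F\<close> can occur.  Both would give
  a conflict-free coloring in which all edges have the same color.  Then no two edges share
  an endpoint, which is impossible in a connected graph with at least two edges
  (\<open>conflict_free_not_monochromatic\<close>).
\<close>

lemma finite_edges: "simple_graph G \<Longrightarrow> finite (edges G)"
  unfolding simple_graph_def by (meson finite_Pow_iff finite_subset PowI subsetI)

lemma closed_edge_nbhd_subset: "closed_edge_nbhd G u v \<subseteq> edges G"
  by (auto simp: closed_edge_nbhd_def incident_edges_def)

lemma edge_eq_pair:
  assumes "simple_graph G" "e \<in> edges G" "u \<in> e" "v \<in> e" "u \<noteq> v"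
  shows "e = {u, v}"
proof -
  have "card e = 2" using assms by (simp add: simple_graph_def)
  then show ?thesis using assms(3-5) by (auto simp: card_2_iff)
qed

lemma conflict_free_iff_card:
  "conflict_free G c \<longleftrightarrow>
     (\<forall>u v. {u, v} \<in> edges G \<longrightarrow> (\<exists>i. card {e \<in> closed_edge_nbhd G u v. c e = i} = 1))"
proof -
  have "(\<exists>!e. P e) \<longleftrightarrow> card {e. P e} = 1" for P :: "'a set \<Rightarrow> bool"
    by (auto simp: card_1_singleton_iff)
  then show ?thesis by (simp add: conflict_free_def)
qed

text \<open>
  This is inclusion-exclusion for the edges of \<open>H\<close> at \<open>u\<close> and those at \<open>v\<close>; their
  intersection consists of \<open>uv\<close> alone if \<open>uv \<in> H\<close>, and is empty otherwise.
\<close>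

lemma degree_in_add_eq_card:
  assumes G: "simple_graph G" and uv: "{u, v} \<in> edges G" and H: "H \<subseteq> edges G"
  shows "degree_in H u + degree_in H v =
    card (H \<inter> closed_edge_nbhd G u v) + (if {u, v} \<in> H then 1 else 0)"
proof -
  have "finite H" using finite_edges[OF G] H by (rule rev_finite_subset)
  then have fin: "finite (incident_edges H u)" "finite (incident_edges H v)"
    by (auto simp: incident_edges_def)
  have "card {u, v} = 2" using G uv by (simp add: simple_graph_def)
  then have "u \<noteq> v" by auto
  then have "incident_edges H u \<inter> incident_edges H v = (if {u, v} \<in> H then {{u, v}} else {})"
  proof -
    have "e = {u, v}" if "e \<in> H" "u \<in> e" "v \<in> e" for e
      using edge_eq_pair[OF G _ that(2,3) \<open>u \<noteq> v\<close>] H that(1) by blast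
    then have "incident_edges H u \<inter> incident_edges H v = {e \<in> H. e = {u, v}}"
      unfolding incident_edges_def by blast
    then show ?thesis by auto
  qed
  moreover have "incident_edges H u \<union> incident_edges H v = H \<inter> closed_edge_nbhd G u v"
    using H by (auto simp: incident_edges_def closed_edge_nbhd_def)
  ultimately show ?thesis
    using card_Un_Int[OF fin] by (simp add: degree_in_def)
qed

lemma degree_in_Diff:
  assumes "finite E" "F \<subseteq> E"
  shows "degree_in (E - F) v = degree_in E v - degree_in F v"
proof -
  have "incident_edges (E - F) v = incident_edges E v - incident_edges F v"
    by (auto simp: incident_edges_def)
  moreover have "incident_edges F v \<subseteq> incident_edges E v" "finite (incident_edges E v)"
    using assms by (auto simp: incident_edges_def)
  ultimately show ?thesis
    by (simp add: degree_in_def card_Diff_subset finite_subset)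
qed

text \<open>
  For \<open>uv \<in> F\<close> the correction term for \<open>uv\<close> appears in the count for \<open>F\<close>, for \<open>uv \<notin> F\<close> in the
  count for the complement; this is why the values 2 and 1 change places between the two
  implications.
\<close>

lemma degree_conditions_iff:
  assumes G: "simple_graph G" and uv: "{u, v} \<in> edges G" and F: "F \<subseteq> edges G"
  shows
    "(({u, v} \<in> F \<longrightarrow>
         degree_in F u + degree_in F v = 2 \<or>
         (degree_in (edges G) u - degree_in F u) + (degree_in (edges G) v - degree_in F v) = 1) \<and>
      ({u, v} \<notin> F \<longrightarrow>
         degree_in F u + degree_in F v = 1 \<or>
         (degree_in (edges G) u - degree_in F u) + (degree_in (edges G) v - degree_in F v) = 2))
     \<longleftrightarrow> card (F \<inter> closed_edge_nbhd G u v) = 1 \<or>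
         card ((edges G - F) \<inter> closed_edge_nbhd G u v) = 1"
  using degree_in_add_eq_card[OF G uv F] degree_in_add_eq_card[OF G uv Diff_subset, of F] uv
  by (simp add: degree_in_Diff[OF finite_edges[OF G] F])

lemma conflict_free_2_iff:
  assumes c: "edge_coloring G 2 c"
  defines "F \<equiv> {e \<in> edges G. c e = 1}"
  shows "conflict_free G c \<longleftrightarrow> (\<forall>u v. {u, v} \<in> edges G \<longrightarrow>
    card (F \<inter> closed_edge_nbhd G u v) = 1 \<or> card ((edges G - F) \<inter> closed_edge_nbhd G u v) = 1)"
proof -
  have col: "c e = 1 \<or> c e = 2" if "e \<in> edges G" for e
    using c that by (force simp: edge_coloring_def)
  have "(\<exists>i. card {e \<in> closed_edge_nbhd G u v. c e = i} = 1) \<longleftrightarrow>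
    card (F \<inter> closed_edge_nbhd G u v) = 1 \<or> card ((edges G - F) \<inter> closed_edge_nbhd G u v) = 1"
    for u v
  proof -
    let ?N = "closed_edge_nbhd G u v"
    have 1: "{e \<in> ?N. c e = 1} = F \<inter> ?N" and 2: "{e \<in> ?N. c e = 2} = (edges G - F) \<inter> ?N"
      using closed_edge_nbhd_subset[of G u v] col by (auto simp: F_def)
    have "{e \<in> ?N. c e = i} = {}" if "i \<noteq> 1" "i \<noteq> 2" for i
      using closed_edge_nbhd_subset[of G u v] col that by blast
    then have "i = 1 \<or> i = 2" if "card {e \<in> ?N. c e = i} = 1" for i
      using that by (metis card.empty zero_neq_one)
    then show ?thesis using 1 2 by metis
  qed
  then show ?thesis by (simp add: conflict_free_iff_card)
qed

text \<open>
  If all edges have the same color, the unique color at \<open>uv\<close> can only be that one, so \<open>uv\<close> is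
  the only edge in its closed neighborhood.  Hence no path from \<open>u\<close> leaves \<open>{u, v}\<close>, and by
  connectedness \<open>uv\<close> is the only edge of the graph.
\<close>

lemma conflict_free_not_monochromatic:
  assumes G: "simple_graph G" "connected_graph G" and E: "card (edges G) \<ge> 2"
    and cf: "conflict_free G c"
  shows "\<not> (\<forall>e\<in>edges G. c e = k)"
proof
  assume mono: "\<forall>e\<in>edges G. c e = k"
  obtain e where e: "e \<in> edges G"
    using E by fastforce
  then obtain u v where uv: "e = {u, v}" "u \<noteq> v"
    using G(1) by (auto simp: simple_graph_def card_2_iff)
  have e_nbhd: "e \<in> closed_edge_nbhd G u v"
    using e uv by (simp add: closed_edge_nbhd_def incident_edges_def)
  obtain i where "\<exists>!f. f \<in> closed_edge_nbhd G u v \<and> c f = i"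
    using cf e unfolding conflict_free_def uv(1) by metis
  then have only: "f = e" if "f \<in> closed_edge_nbhd G u v" for f
    using that e_nbhd closed_edge_nbhd_subset[of G u v] mono by (metis subsetD)
  have reach: "y \<in> {u, v}" if "(adj G)\<^sup>*\<^sup>* u y" for y
    using that
  proof induction
    case (step x y)
    then have "{x, y} \<in> closed_edge_nbhd G u v"
      by (auto simp: adj_def closed_edge_nbhd_def incident_edges_def)
    then show ?case using only uv by blast
  qed simp
  have V: "f \<subseteq> verts G" if "f \<in> edges G" for f
    using G(1) that by (simp add: simple_graph_def)
  then have "f \<subseteq> e" if "f \<in> edges G" for f
    using V[OF that] V[OF e] uv reach G(2) unfolding connected_graph_def by blast
  then have "f = e" if "f \<in> edges G" for f
    using G(1) e that uv(1) card_subset_eq[of e f] by (simp add: simple_graph_def)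
  then have "edges G \<subseteq> {e}" by blast
  then have "card (edges G) \<le> card {e}" by (intro card_mono) auto
  then show False using E by simp
qed

lemma cf_chromatic_index_eq_2_iff:
  assumes G: "simple_graph G" "connected_graph G" and E: "card (edges G) \<ge> 2"
  shows "cf_chromatic_index G = 2 \<longleftrightarrow> (\<exists>c. edge_coloring G 2 c \<and> conflict_free G c)"
proof
  show "\<exists>c. edge_coloring G 2 c \<and> conflict_free G c" if "cf_chromatic_index G = 2"
    using LeastI_ex[OF ex_conflict_free_edge_coloring[OF G(1)]] that
    by (simp add: cf_chromatic_index_def)
next
  assume ex: "\<exists>c. edge_coloring G 2 c \<and> conflict_free G c"
  show "cf_chromatic_index G = 2"
    unfolding cf_chromatic_index_def
  proof (rule Least_equality)
    fix k assume "\<exists>c. edge_coloring G k c \<and> conflict_free G c"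
    then obtain c where c: "edge_coloring G k c" "conflict_free G c" by blast
    show "2 \<le> k"
    proof (rule ccontr)
      assume "\<not> 2 \<le> k"
      then have "\<forall>e\<in>edges G. c e = 1"
        using c(1) by (fastforce simp: edge_coloring_def)
      then show False
        using conflict_free_not_monochromatic[OF G E c(2)] by blast
    qed
  qed (rule ex)
qed

theorem theorem1p9:
  fixes T :: "'a graph"
  assumes "tree T" and "card (edges T) \<ge> 2"
  shows "cf_chromatic_index T = 2 \<longleftrightarrow>
    (\<exists>F. F \<noteq> {} \<and> F \<subset> edges T \<and>
      (\<forall>u v. {u, v} \<in> edges T \<longrightarrow>
        ({u, v} \<in> F \<longrightarrow>
           degree_in F u + degree_in F v = 2 \<or>
           (degree_in (edges T) u - degree_in F u) + (degree_in (edges T) v - degree_in F v) = 1) \<and>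
        ({u, v} \<notin> F \<longrightarrow>
           degree_in F u + degree_in F v = 1 \<or>
           (degree_in (edges T) u - degree_in F u) + (degree_in (edges T) v - degree_in F v) = 2)))"
proof -
  have G: "simple_graph T" "connected_graph T"
    using assms(1) by (simp_all add: tree_def)
  let ?one = "\<lambda>F u v. card (F \<inter> closed_edge_nbhd T u v) = 1 \<or>
    card ((edges T - F) \<inter> closed_edge_nbhd T u v) = 1"
  have "(\<exists>c. edge_coloring T 2 c \<and> conflict_free T c) \<longleftrightarrow>
    (\<exists>F. F \<noteq> {} \<and> F \<subset> edges T \<and> (\<forall>u v. {u, v} \<in> edges T \<longrightarrow> ?one F u v))"
  proof
    assume "\<exists>c. edge_coloring T 2 c \<and> conflict_free T c"
    then obtain c where c: "edge_coloring T 2 c" "conflict_free T c" by blast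
    let ?F = "{e \<in> edges T. c e = 1}"
    have not_mono: "\<not> (\<forall>e\<in>edges T. c e = k)" for k
      by (rule conflict_free_not_monochromatic[OF G assms(2) c(2)])
    have "c e = 1 \<or> c e = 2" if "e \<in> edges T" for e
      using c(1) that by (force simp: edge_coloring_def)
    then have "?F \<noteq> {}" using not_mono[of 2] by blast
    moreover have "?F \<subset> edges T" using not_mono[of 1] by blast
    ultimately show "\<exists>F. F \<noteq> {} \<and> F \<subset> edges T \<and> (\<forall>u v. {u, v} \<in> edges T \<longrightarrow> ?one F u v)"
      using iffD1[OF conflict_free_2_iff[OF c(1)] c(2)] by (intro exI[of _ ?F] conjI)
  next
    assume "\<exists>F. F \<noteq> {} \<and> F \<subset> edges T \<and> (\<forall>u v. {u, v} \<in> edges T \<longrightarrow> ?one F u v)"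
    then obtain F where F: "F \<subset> edges T" "\<forall>u v. {u, v} \<in> edges T \<longrightarrow> ?one F u v" by blast
    define c where "c e = (if e \<in> F then 1 else 2 :: nat)" for e
    have c: "edge_coloring T 2 c" by (simp add: edge_coloring_def c_def)
    have "{e \<in> edges T. c e = 1} = F" using F(1) by (auto simp: c_def)
    then have "conflict_free T c" using conflict_free_2_iff[OF c] F(2) by simp
    then show "\<exists>c. edge_coloring T 2 c \<and> conflict_free T c" using c by blast
  qed
  then show ?thesis
    unfolding cf_chromatic_index_eq_2_iff[OF G assms(2)]
    by (elim ssubst, intro ex_cong1 conj_cong refl all_cong1 imp_cong
        degree_conditions_iff[OF G(1), symmetric]) auto
qed

end
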